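(* Let $P$ be an upward directed GPEA and let $U$ be a $\gamma$-unitization of $P$. Then there is a smallest nontrivial normal Riesz ideal in $U$ iff there is a smallest normal Riesz $\gamma$-ideal in $P$.
   Context: $P$ is a GPEA (partial $\oplus$, constant $0$; partial associativity; conjugation; two-sided cancellation; neutral $0$; positivity), ordered by $a\le b$ iff $a\oplus c=b$ for some $c$; for $a\le b$, $a/b$ is the unique $c$ with $a\oplus c=b$ and $b\backslash a$ the unique $d$ with $d\oplus a=b$. Upward directed: any two elements have a common upper bound. $\gamma$ is a unitizing GPEA-automorphism ($\gamma a\oplus b$ defined iff $b\oplus a$ defined). The $\gamma$-unitization $U=P\cup P^\eta$ ($\eta$ a bijection onto a disjoint set, $1:=\eta0$): sums in $P$ as in $P$; $a+\eta b$ defined iff $a\le b$, equal to $\eta(b\backslash a)$; $\eta a+b$ defined iff $\gamma b\le a$, equal to $\eta(\gamma b/a)$; no sums within $P^\eta$; $U$ is a pseudo effect algebra. Ideal: nonempty down-set closed under existing sums; nontrivial: different from $\{0\}$; normal: $a\oplus c=c\oplus b\Rightarrow(a\in I\Leftrightarrow b\in I)$; $\gamma$-ideal: $a\in I\Leftrightarrow\gamma a\in I$. Riesz ideal: (R1) if $i\in I$, $i\le a\oplus b$ then $i\le j\oplus k$ for some $j,k\in I$, $j\le a$, $k\le b$; (R2) if $i\in I$, $i\le a$: (i) if $(a\backslash i)\oplus b$ exists there is $j\in I$, $j\le b$, with $a\oplus(j/b)$ existing; (ii) if $b\oplus(i/a)$ exists there is $k\in I$, $k\le b$, with $(b\backslash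 k)\oplus a$ existing.
   Formalization: P is assumed to have no greatest element, and the smallest normal Riesz γ-ideal in P is taken among nontrivial ones; otherwise the claim fails, e.g. for P={0,p} with p⊕p undefined, where U is the four-element Boolean algebra. *)

theory Defs
  imports Main
begin

text \<open>A partial algebra with an explicit carrier; \<open>x \<oplus> y = None\<close> means that the sum is undefined.
  The value of \<open>\<oplus>\<close> on arguments outside the carrier is irrelevant.\<close>

record 'a partial_alg =
  carrier :: "'a set"
  psum :: "'a \<Rightarrow> 'a \<Rightarrow> 'a option"  (infixl "\<oplus>\<index>" 65)
  pzero :: 'a  ("\<zero>\<index>")

definition ple :: "('a, 'z) partial_alg_scheme \<Rightarrow> 'a \<Rightarrow> 'a \<Rightarrow> bool"  (infix "\<preceq>\<index>" 50)
  where "a \<preceq>\<^bsub>P\<^esub> b \<longleftrightarrow> a \<in> carrier P \<and> b \<in> carrier P \<and> (\<exists>c\<in>carrier P. a \<oplus>\<^bsub>P\<^esub> c = Some b)"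

text \<open>For \<open>a \<preceq> b\<close>, \<open>lquot P a b\<close> is the element \<open>a / b\<close> and \<open>rquot P b a\<close> is the element
  \<open>b \ a\<close>; both are unspecified if \<open>a \<preceq> b\<close> fails.\<close>

definition lquot :: "('a, 'z) partial_alg_scheme \<Rightarrow> 'a \<Rightarrow> 'a \<Rightarrow> 'a"
  where "lquot P a b = (THE c. c \<in> carrier P \<and> a \<oplus>\<^bsub>P\<^esub> c = Some b)"

definition rquot :: "('a, 'z) partial_alg_scheme \<Rightarrow> 'a \<Rightarrow> 'a \<Rightarrow> 'a"
  where "rquot P b a = (THE d. d \<in> carrier P \<and> d \<oplus>\<^bsub>P\<^esub> a = Some b)"

text \<open>In \<open>assoc\<close>, \<open>Option.bind\<close> expresses that one side is defined iff the other one is, and that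
  they then agree.\<close>

locale gpea =
  fixes P :: "'a partial_alg" (structure)
  assumes zero_closed: "\<zero> \<in> carrier P"
    and sum_closed: "\<lbrakk>a \<in> carrier P; b \<in> carrier P; a \<oplus> b = Some c\<rbrakk> \<Longrightarrow> c \<in> carrier P"
    and assoc: "\<lbrakk>a \<in> carrier P; b \<in> carrier P; c \<in> carrier P\<rbrakk> \<Longrightarrow>
      Option.bind (a \<oplus> b) (\<lambda>d. d \<oplus> c) = Option.bind (b \<oplus> c) (\<lambda>e. a \<oplus> e)"
    and conjugation: "\<lbrakk>a \<in> carrier P; b \<in> carrier P; a \<oplus> b = Some s\<rbrakk> \<Longrightarrow>
      \<exists>d\<in>carrier P. \<exists>e\<in>carrier P. d \<oplus> a = Some s \<and> b \<oplus> e = Some s"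
    and cancel_left: "\<lbrakk>a \<in> carrier P; b \<in> carrier P; c \<in> carrier P;
      a \<oplus> b = Some s; a \<oplus> c = Some s\<rbrakk> \<Longrightarrow> b = c"
    and cancel_right: "\<lbrakk>a \<in> carrier P; b \<in> carrier P; c \<in> carrier P;
      b \<oplus> a = Some s; c \<oplus> a = Some s\<rbrakk> \<Longrightarrow> b = c"
    and zero_right: "a \<in> carrier P \<Longrightarrow> a \<oplus> \<zero> = Some a"
    and zero_left: "a \<in> carrier P \<Longrightarrow> \<zero> \<oplus> a = Some a"
    and positivity: "\<lbrakk>a \<in> carrier P; b \<in> carrier P; a \<oplus> b = Some \<zero>\<rbrakk> \<Longrightarrow> a = \<zero> \<and> b = \<zero>"

definition upward_directed :: "('a, 'z) partial_alg_scheme \<Rightarrow> bool"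
  where "upward_directed P \<longleftrightarrow>
    (\<forall>a\<in>carrier P. \<forall>b\<in>carrier P. \<exists>u\<in>carrier P. a \<preceq>\<^bsub>P\<^esub> u \<and> b \<preceq>\<^bsub>P\<^esub> u)"

text \<open>A generalized pseudo effect algebra with a greatest element \<open>t\<close> is already a pseudo
  effect algebra. In its unitization the ideals \<open>P\<close> and \<open>{\<zero>, \<eta> t}\<close> are both normal Riesz ideals
  and meet in \<open>{\<zero>}\<close>, so if \<open>t \<noteq> \<zero>\<close> there is no smallest nontrivial one, whatever the
  ideals of \<open>P\<close> are.\<close>

definition has_greatest :: "('a, 'z) partial_alg_scheme \<Rightarrow> bool"
  where "has_greatest P \<longleftrightarrow> (\<exists>t\<in>carrier P. \<forall>a\<in>carrier P. a \<preceq>\<^bsub>P\<^esub> t)"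

definition gpea_automorphism :: "('a, 'z) partial_alg_scheme \<Rightarrow> ('a \<Rightarrow> 'a) \<Rightarrow> bool"
  where "gpea_automorphism P \<gamma> \<longleftrightarrow> bij_betw \<gamma> (carrier P) (carrier P) \<and>
    (\<forall>a\<in>carrier P. \<forall>b\<in>carrier P. \<gamma> a \<oplus>\<^bsub>P\<^esub> \<gamma> b = map_option \<gamma> (a \<oplus>\<^bsub>P\<^esub> b))"

definition unitizing :: "('a, 'z) partial_alg_scheme \<Rightarrow> ('a \<Rightarrow> 'a) \<Rightarrow> bool"
  where "unitizing P \<gamma> \<longleftrightarrow> gpea_automorphism P \<gamma> \<and>
    (\<forall>a\<in>carrier P. \<forall>b\<in>carrier P. \<gamma> a \<oplus>\<^bsub>P\<^esub> b \<noteq> None \<longleftrightarrow> b \<oplus>\<^bsub>P\<^esub> a \<noteq> None)"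

text \<open>\<open>U\<close> is the \<open>\<gamma>\<close>-unitization of \<open>P\<close> along the bijection \<open>\<eta>\<close> from \<open>P\<close> onto a disjoint
  set; its unit is \<open>\<eta> \<zero>\<close>.\<close>

locale gamma_unitization = gpea P
  for P :: "'a partial_alg" (structure) +
  fixes \<gamma> :: "'a \<Rightarrow> 'a" and \<eta> :: "'a \<Rightarrow> 'a" and U :: "'a partial_alg"
  assumes unitizing: "unitizing P \<gamma>"
    and eta_inj: "inj_on \<eta> (carrier P)"
    and eta_disjoint: "carrier P \<inter> \<eta> ` carrier P = {}"
    and carrier_U: "carrier U = carrier P \<union> \<eta> ` carrier P"
    and zero_U: "\<zero>\<^bsub>U\<^esub> = \<zero>"
    and sum_PP: "\<lbrakk>a \<in> carrier P; b \<in> carrier P\<rbrakk> \<Longrightarrow> a \<oplus>\<^bsub>U\<^esub> b = a \<oplus> b"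
    and sum_P_eta: "\<lbrakk>a \<in> carrier P; b \<in> carrier P\<rbrakk> \<Longrightarrow>
      a \<oplus>\<^bsub>U\<^esub> \<eta> b = (if a \<preceq> b then Some (\<eta> (rquot P b a)) else None)"
    and sum_eta_P: "\<lbrakk>a \<in> carrier P; b \<in> carrier P\<rbrakk> \<Longrightarrow>
      \<eta> a \<oplus>\<^bsub>U\<^esub> b = (if \<gamma> b \<preceq> a then Some (\<eta> (lquot P (\<gamma> b) a)) else None)"
    and sum_eta_eta: "\<lbrakk>a \<in> carrier P; b \<in> carrier P\<rbrakk> \<Longrightarrow> \<eta> a \<oplus>\<^bsub>U\<^esub> \<eta> b = None"

definition pideal :: "('a, 'z) partial_alg_scheme \<Rightarrow> 'a set \<Rightarrow> bool"
  where "pideal P I \<longleftrightarrow> I \<noteq> {} \<and> I \<subseteq> carrier P \<and>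
    (\<forall>i\<in>I. \<forall>a\<in>carrier P. a \<preceq>\<^bsub>P\<^esub> i \<longrightarrow> a \<in> I) \<and>
    (\<forall>i\<in>I. \<forall>j\<in>I. \<forall>s. i \<oplus>\<^bsub>P\<^esub> j = Some s \<longrightarrow> s \<in> I)"

definition nontrivial :: "('a, 'z) partial_alg_scheme \<Rightarrow> 'a set \<Rightarrow> bool"
  where "nontrivial P I \<longleftrightarrow> I \<noteq> {\<zero>\<^bsub>P\<^esub>}"

definition normal :: "('a, 'z) partial_alg_scheme \<Rightarrow> 'a set \<Rightarrow> bool"
  where "normal P I \<longleftrightarrow> (\<forall>a\<in>carrier P. \<forall>b\<in>carrier P. \<forall>c\<in>carrier P. \<forall>s.
    a \<oplus>\<^bsub>P\<^esub> c = Some s \<and> c \<oplus>\<^bsub>P\<^esub> b = Some s \<longrightarrow> (a \<in> I \<longleftrightarrow> b \<in> I))"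

definition gamma_closed :: "('a, 'z) partial_alg_scheme \<Rightarrow> ('a \<Rightarrow> 'a) \<Rightarrow> 'a set \<Rightarrow> bool"
  where "gamma_closed P \<gamma> I \<longleftrightarrow> (\<forall>a\<in>carrier P. a \<in> I \<longleftrightarrow> \<gamma> a \<in> I)"

definition riesz1 :: "('a, 'z) partial_alg_scheme \<Rightarrow> 'a set \<Rightarrow> bool"
  where "riesz1 P I \<longleftrightarrow> (\<forall>i\<in>I. \<forall>a\<in>carrier P. \<forall>b\<in>carrier P. \<forall>s.
    a \<oplus>\<^bsub>P\<^esub> b = Some s \<and> i \<preceq>\<^bsub>P\<^esub> s \<longrightarrow>
    (\<exists>j\<in>I. \<exists>k\<in>I. \<exists>t. j \<preceq>\<^bsub>P\<^esub> a \<and> k \<preceq>\<^bsub>P\<^esub> b \<and> j \<oplus>\<^bsub>P\<^esub> k = Some t \<and> i \<preceq>\<^bsub>P\<^esub> t))"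

definition riesz2 :: "('a, 'z) partial_alg_scheme \<Rightarrow> 'a set \<Rightarrow> bool"
  where "riesz2 P I \<longleftrightarrow> (\<forall>i\<in>I. \<forall>a\<in>carrier P. i \<preceq>\<^bsub>P\<^esub> a \<longrightarrow> (\<forall>b\<in>carrier P.
    (rquot P a i \<oplus>\<^bsub>P\<^esub> b \<noteq> None \<longrightarrow> (\<exists>j\<in>I. j \<preceq>\<^bsub>P\<^esub> b \<and> a \<oplus>\<^bsub>P\<^esub> lquot P j b \<noteq> None)) \<and>
    (b \<oplus>\<^bsub>P\<^esub> lquot P i a \<noteq> None \<longrightarrow> (\<exists>k\<in>I. k \<preceq>\<^bsub>P\<^esub> b \<and> rquot P b k \<oplus>\<^bsub>P\<^esub> a \<noteq> None))))"

definition riesz_ideal :: "('a, 'z) partial_alg_scheme \<Rightarrow> 'a set \<Rightarrow> bool"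
  where "riesz_ideal P I \<longleftrightarrow> pideal P I \<and> riesz1 P I \<and> riesz2 P I"

definition has_smallest :: "('a set \<Rightarrow> bool) \<Rightarrow> bool"
  where "has_smallest Q \<longleftrightarrow> (\<exists>I. Q I \<and> (\<forall>J. Q J \<longrightarrow> I \<subseteq> J))"

end

theory Submission
  imports Defs
begin

text \<open>The key is the correspondence of ideals: intersecting with \<open>P\<close> turns normal Riesz ideals of
  \<open>U\<close> into normal Riesz \<open>\<gamma>\<close>-ideals of \<open>P\<close>, and conversely every normal Riesz \<open>\<gamma>\<close>-ideal
  of an upward directed \<open>P\<close> is a normal Riesz ideal of \<open>U\<close>. For the latter, statements about sums
  with elements \<open>\<eta> b\<close> translate into inequalities in \<open>P\<close>; an upper bound of the elements involved
  makes (R1) in \<open>P\<close> applicable, and (R1) alone suffices. In particular \<open>P\<close> itself is a normal Riesz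
  ideal of \<open>U\<close>, so a smallest one lies in \<open>P\<close>. Finally, if a normal Riesz ideal \<open>J \<noteq> {\<zero>}\<close> of \<open>U\<close>
  meets \<open>P\<close> in \<open>{\<zero>}\<close> only, then any \<open>\<eta> a \<in> J\<close> has \<open>a\<close> maximal in \<open>P\<close>, hence greatest, as
  \<open>b \<le> \<eta> a\<close> holds iff \<open>a \<oplus> b\<close> exists.\<close>

section \<open>Order and quotients in a GPEA\<close>

context gpea
begin

lemma assocE1:
  assumes "a \<oplus> b = Some d" "d \<oplus> c = Some e" "a \<in> carrier P" "b \<in> carrier P" "c \<in> carrier P"
  obtains f where "f \<in> carrier P" "b \<oplus> c = Some f" "a \<oplus> f = Some e"
proof -
  have "Option.bind (b \<oplus> c) (\<lambda>e. a \<oplus> e) = Some e"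
    using assoc[of a b c] assms by simp
  then show thesis
    using that sum_closed[OF assms(4,5)] by (auto simp: bind_eq_Some_conv)
qed

lemma assocE2:
  assumes "b \<oplus> c = Some f" "a \<oplus> f = Some e" "a \<in> carrier P" "b \<in> carrier P" "c \<in> carrier P"
  obtains d where "d \<in> carrier P" "a \<oplus> b = Some d" "d \<oplus> c = Some e"
proof -
  have "Option.bind (a \<oplus> b) (\<lambda>d. d \<oplus> c) = Some e"
    using assoc[of a b c] assms by simp
  then show thesis
    using that sum_closed[OF assms(3,4)] by (auto simp: bind_eq_Some_conv)
qed

lemma pleI_left: "\<lbrakk>a \<in> carrier P; c \<in> carrier P; a \<oplus> c = Some b\<rbrakk> \<Longrightarrow> a \<preceq> b"
  unfolding ple_def using sum_closed by blast

lemma pleI_right: "\<lbrakk>a \<in> carrier P; c \<in> carrier P; c \<oplus> a = Some b\<rbrakk> \<Longrightarrow> a \<preceq> b"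
  using conjugation[of c a b] pleI_left by blast

lemma pleE_left:
  assumes "a \<preceq> b"
  obtains c where "a \<in> carrier P" "b \<in> carrier P" "c \<in> carrier P" "a \<oplus> c = Some b"
  using assms unfolding ple_def by blast

lemma pleE_right:
  assumes "a \<preceq> b"
  obtains c where "a \<in> carrier P" "b \<in> carrier P" "c \<in> carrier P" "c \<oplus> a = Some b"
  using pleE_left[OF assms] conjugation[of a _ b] by metis

lemma ple_trans:
  assumes "a \<preceq> b" "b \<preceq> c"
  shows "a \<preceq> c"
proof -
  obtain x where x: "a \<in> carrier P" "x \<in> carrier P" "a \<oplus> x = Some b"
    using assms(1) by (rule pleE_left)
  obtain y where y: "y \<in> carrier P" "b \<oplus> y = Some c"
    using assms(2) by (rule pleE_left)
  obtain z where "z \<in> carrier P" "a \<oplus> z = Some c"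
    by (rule assocE1[OF x(3) y(2) x(1,2) y(1)])
  then show ?thesis using x(1) pleI_left by blast
qed

lemma zero_ple: "a \<in> carrier P \<Longrightarrow> \<zero> \<preceq> a"
  using zero_left zero_closed pleI_left by blast

lemma ple_refl: "a \<in> carrier P \<Longrightarrow> a \<preceq> a"
  using zero_right zero_closed pleI_left by blast

lemma sum_right_mono:
  assumes "k \<preceq> x" "s \<oplus> x = Some u" "s \<in> carrier P"
  obtains v where "s \<oplus> k = Some v" "v \<preceq> u"
proof -
  obtain y where y: "k \<in> carrier P" "y \<in> carrier P" "k \<oplus> y = Some x"
    using assms(1) pleE_left by metis
  obtain v where "v \<in> carrier P" "s \<oplus> k = Some v" "v \<oplus> y = Some u"
    using assocE2[OF y(3) assms(2,3) y(1,2)] by metis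
  then show thesis using that pleI_left y(2) by blast
qed

lemma lquot_eq: "\<lbrakk>a \<in> carrier P; c \<in> carrier P; a \<oplus> c = Some b\<rbrakk> \<Longrightarrow> lquot P a b = c"
  unfolding lquot_def using cancel_left by blast

lemma rquot_eq: "\<lbrakk>a \<in> carrier P; c \<in> carrier P; c \<oplus> a = Some b\<rbrakk> \<Longrightarrow> rquot P b a = c"
  unfolding rquot_def using cancel_right by blast

lemma lquot: "a \<preceq> b \<Longrightarrow> lquot P a b \<in> carrier P \<and> a \<oplus> lquot P a b = Some b"
  using lquot_eq by (metis pleE_left)

lemma rquot: "a \<preceq> b \<Longrightarrow> rquot P b a \<in> carrier P \<and> rquot P b a \<oplus> a = Some b"
  using rquot_eq by (metis pleE_right)

section \<open>Consequences of (R1)\<close>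

lemma riesz1E:
  assumes "riesz1 P I" "I \<subseteq> carrier P" "i \<in> I" "i \<preceq> s"
    and "a \<oplus> b = Some s" "a \<in> carrier P" "b \<in> carrier P"
  obtains j k t where "j \<in> I" "k \<in> I" "j \<in> carrier P" "k \<in> carrier P"
    "j \<preceq> a" "k \<preceq> b" "j \<oplus> k = Some t" "i \<preceq> t"
  using assms unfolding riesz1_def by blast

text \<open>This is what (R1) of \<open>U\<close> requires for \<open>a\<close> plus
  \<open>\<eta> s\<close>, whose sum is \<open>\<eta> d\<close>: there \<open>i\<close> lies below
  \<open>\<eta> d\<close> iff \<open>d \<oplus> i\<close> is defined, and \<open>k\<close> lies
  below \<open>\<eta> s\<close> iff \<open>s \<oplus> k\<close> is defined. Directedness bounds
  \<open>s\<close> and \<open>t\<close> by a common \<open>u\<close>, which makes (R1) of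
  \<open>P\<close> applicable.\<close>

lemma riesz1_directed:
  assumes dir: "upward_directed P" and I: "riesz1 P I" "I \<subseteq> carrier P" and i: "i \<in> I"
    and C: "a \<in> carrier P" "d \<in> carrier P"
    and s: "d \<oplus> a = Some s" and t: "d \<oplus> i = Some t"
  obtains j k v where "j \<in> I" "k \<in> I" "j \<preceq> a" "j \<oplus> k = Some v" "i \<preceq> v" "s \<oplus> k \<noteq> None"
proof -
  have iC: "i \<in> carrier P" using I i by blast
  have sC: "s \<in> carrier P" and tC: "t \<in> carrier P" using sum_closed C iC s t by blast+
  then obtain u where "s \<preceq> u" "t \<preceq> u" using dir unfolding upward_directed_def by blast
  then obtain x y where x: "x \<in> carrier P" "s \<oplus> x = Some u" and y: "y \<in> carrier P" "t \<oplus> y = Some u"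
    by (metis pleE_left)
  obtain f where f: "f \<in> carrier P" "a \<oplus> x = Some f" "d \<oplus> f = Some u"
    using assocE1[OF s x(2)] C x by metis
  obtain g where g: "g \<in> carrier P" "i \<oplus> y = Some g" "d \<oplus> g = Some u"
    using assocE1[OF t y(2)] C iC y by metis
  \<comment> \<open>The bound \<open>u\<close> is both \<open>d \<oplus> (a \<oplus> x)\<close> and
    \<open>d \<oplus> (i \<oplus> y)\<close>; cancelling \<open>d\<close> puts \<open>i\<close>
    below \<open>a \<oplus> x\<close>.\<close>
  have "g = f" using cancel_left f g C by blast
  then have "i \<preceq> f" using pleI_left g iC y by blast
  then obtain j k v where "j \<in> I" "k \<in> I" "j \<preceq> a" "k \<preceq> x" "j \<oplus> k = Some v" "i \<preceq> v"
    using riesz1E[OF I i _ f(2)] C x by metis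
  moreover have "s \<oplus> k \<noteq> None"
    by (rule sum_right_mono[OF \<open>k \<preceq> x\<close> x(2) sC]) simp
  ultimately show thesis using that by blast
qed

text \<open>Serves (R2) of \<open>U\<close> when only the second element is in the upper copy:
  enlarging \<open>b\<close> by some \<open>k\<close> from \<open>I\<close> makes up for the
  \<open>i\<close> missing from \<open>c\<close>. With \<open>b\<close> written as
  \<open>c \<oplus> x\<close>, it is enough that \<open>i\<close> lies below
  \<open>x \<oplus> k\<close>.\<close>

lemma riesz1_compensate:
  assumes dir: "upward_directed P" and I: "riesz1 P I" "I \<subseteq> carrier P" and i: "i \<in> I"
    and c: "c \<in> carrier P" "c \<oplus> i = Some a" and le: "c \<preceq> b"
  obtains k v where "k \<in> I" "b \<oplus> k = Some v" "a \<preceq> v"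
proof -
  have iC: "i \<in> carrier P" using I i by blast
  obtain x where x: "x \<in> carrier P" "c \<oplus> x = Some b" using le pleE_left by metis
  obtain j k v where jk: "j \<in> I" "k \<in> I" "j \<preceq> x" "j \<oplus> k = Some v" "i \<preceq> v" "b \<oplus> k \<noteq> None"
    using riesz1_directed[OF dir I i x(1) c(1) x(2) c(2)] by metis
  have kC: "k \<in> carrier P" and jC: "j \<in> carrier P" using I jk by blast+
  obtain w where w: "b \<oplus> k = Some w" using jk by blast
  obtain f where f: "f \<in> carrier P" "x \<oplus> k = Some f" "c \<oplus> f = Some w"
    using assocE1[OF x(2) w] c x kC by metis
  obtain m where m: "m \<in> carrier P" "m \<oplus> j = Some x" using jk pleE_right by metis
  \<comment> \<open>Replacing \<open>x\<close> by \<open>m \<oplus> j\<close> shows that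
    \<open>j \<oplus> k\<close> lies below \<open>x \<oplus> k\<close>.\<close>
  obtain v' where "v' \<in> carrier P" "j \<oplus> k = Some v'" "m \<oplus> v' = Some f"
    using assocE1[OF m(2) f(2)] m jC kC by metis
  then have "v \<preceq> f" using jk(4) m(1) pleI_right by simp
  then have "i \<preceq> f" using jk ple_trans by blast
  then have "a \<preceq> w" using sum_right_mono[OF _ f(3) c(1)] c(2) by force
  then show thesis using that jk w by blast
qed

text \<open>Serves (R2) of \<open>U\<close> when only the first element is in the upper copy.
  Removing from \<open>b\<close> what (R1) finds below it leaves \<open>m\<close>; regrouping
  \<open>w\<close> so that \<open>i\<close> stands at its right end then exhibits \<open>m\<close>
  as an initial part of \<open>a\<close>.\<close>

lemma riesz1_subtract:
  assumes I: "riesz1 P I" "I \<subseteq> carrier P" and i: "i \<in> I"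
    and a: "a \<in> carrier P" "a \<oplus> i = Some w" and le: "b \<preceq> w"
  obtains k m where "k \<in> I" "m \<in> carrier P" "m \<oplus> k = Some b" "m \<preceq> a"
proof -
  have iC: "i \<in> carrier P" using I i by blast
  obtain r where r: "r \<in> carrier P" "b \<in> carrier P" "b \<oplus> r = Some w" using le pleE_left by metis
  have "i \<preceq> w" using a iC pleI_right by blast
  \<comment> \<open>The witness \<open>k\<close> of the conclusion is the part called
    \<open>j\<close> here, the one below \<open>b\<close>.\<close>
  then obtain j k t where jk: "j \<in> I" "k \<in> I" "j \<in> carrier P" "k \<in> carrier P"
    "j \<preceq> b" "k \<preceq> r" "j \<oplus> k = Some t" "i \<preceq> t"
    using riesz1E[OF I i _ r(3)] r by metis
  obtain m where m: "m \<in> carrier P" "m \<oplus> j = Some b" using jk pleE_right by metis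
  obtain n where n: "n \<in> carrier P" "k \<oplus> n = Some r" using jk pleE_left by metis
  obtain q where q: "q \<in> carrier P" "q \<oplus> i = Some t" "t \<in> carrier P" using jk pleE_right by metis
  obtain x where x: "x \<in> carrier P" "j \<oplus> r = Some x" "m \<oplus> x = Some w"
    using assocE1[OF m(2) r(3)] m jk r by metis
  obtain t' where "t' \<in> carrier P" "j \<oplus> k = Some t'" "t' \<oplus> n = Some x"
    using assocE2[OF n(2) x(2)] jk n by metis
  then have tn: "t \<oplus> n = Some x" using jk by simp
  obtain y where y: "y \<in> carrier P" "i \<oplus> n = Some y" "q \<oplus> y = Some x"
    using assocE1[OF q(2) tn] q iC n by metis
  \<comment> \<open>By now \<open>w\<close> is
    \<open>m \<oplus> (q \<oplus> (i \<oplus> n))\<close>. Conjugation moves \<open>i\<close> past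
    \<open>n\<close> to the end, where it cancels against \<open>a \<oplus> i\<close>.\<close>
  obtain n' where n': "n' \<in> carrier P" "n' \<oplus> i = Some y" using conjugation iC n y by metis
  obtain z where z: "z \<in> carrier P" "q \<oplus> n' = Some z" "z \<oplus> i = Some x"
    using assocE2[OF n'(2) y(3)] q n' iC by metis
  obtain a' where a': "a' \<in> carrier P" "m \<oplus> z = Some a'" "a' \<oplus> i = Some w"
    using assocE2[OF z(3) x(3)] m z iC by metis
  have "a' = a" using cancel_right a a' iC by blast
  then have "m \<preceq> a" using a' m z pleI_left by blast
  then show thesis using that jk m by blast
qed

end

section \<open>Left-right duality through the opposite algebra\<close>

definition opposite :: "'a partial_alg \<Rightarrow> 'a partial_alg"
  where "opposite P = \<lparr>carrier = carrier P, psum = (\<lambda>a b. psum P b a), pzero = pzero P\<rparr>"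

lemma opposite_simps [simp]:
  "carrier (opposite P) = carrier P"
  "a \<oplus>\<^bsub>opposite P\<^esub> b = b \<oplus>\<^bsub>P\<^esub> a"
  "\<zero>\<^bsub>opposite P\<^esub> = \<zero>\<^bsub>P\<^esub>"
  by (simp_all add: opposite_def)

context gpea
begin

lemma gpea_opposite: "gpea (opposite P)"
proof
  fix a b s
  assume *: "a \<in> carrier (opposite P)" "b \<in> carrier (opposite P)" "a \<oplus>\<^bsub>opposite P\<^esub> b = Some s"
  then show "\<exists>d\<in>carrier (opposite P). \<exists>e\<in>carrier (opposite P).
      d \<oplus>\<^bsub>opposite P\<^esub> a = Some s \<and> b \<oplus>\<^bsub>opposite P\<^esub> e = Some s"
    using conjugation[of b a s] by auto
  show "s \<in> carrier (opposite P)" using * sum_closed[of b a s] by simp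
next
  fix a b c
  assume "a \<in> carrier (opposite P)" "b \<in> carrier (opposite P)" "c \<in> carrier (opposite P)"
  then show "Option.bind (a \<oplus>\<^bsub>opposite P\<^esub> b) (\<lambda>d. d \<oplus>\<^bsub>opposite P\<^esub> c) =
      Option.bind (b \<oplus>\<^bsub>opposite P\<^esub> c) (\<lambda>e. a \<oplus>\<^bsub>opposite P\<^esub> e)"
    using assoc[of c b a] by simp
qed (simp_all, (blast intro: zero_closed cancel_left cancel_right zero_left zero_right dest: positivity)+)

text \<open>Conjugation makes left and right summands of an element the same, so reversing the sum
  keeps the order.\<close>

lemma ple_opposite [simp]: "a \<preceq>\<^bsub>opposite P\<^esub> b \<longleftrightarrow> a \<preceq> b"
  unfolding ple_def[of "opposite P"]
  by (auto intro: pleI_right elim: pleE_right)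

lemma upward_directed_opposite: "upward_directed P \<Longrightarrow> upward_directed (opposite P)"
  unfolding upward_directed_def by simp

lemma riesz1_opposite: "riesz1 P I \<Longrightarrow> riesz1 (opposite P) I"
  unfolding riesz1_def by simp blast

text \<open>The mirrored forms treat sums with the upper-copy element on the left, which translate
  into sums of \<open>P\<close> in reverse order and twisted by \<open>\<gamma>\<close>.\<close>

lemmas riesz1_directed' =
  gpea.riesz1_directed[OF gpea_opposite upward_directed_opposite riesz1_opposite, simplified]
lemmas riesz1_compensate' =
  gpea.riesz1_compensate[OF gpea_opposite upward_directed_opposite riesz1_opposite, simplified]
lemmas riesz1_subtract' =
  gpea.riesz1_subtract[OF gpea_opposite riesz1_opposite, simplified]

section \<open>Ideals of a GPEA\<close>

lemma pidealD:
  assumes "pideal P I"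
  shows "I \<subseteq> carrier P" "i \<in> I \<Longrightarrow> a \<preceq> i \<Longrightarrow> a \<in> I"
    "i \<in> I \<Longrightarrow> j \<in> I \<Longrightarrow> i \<oplus> j = Some s \<Longrightarrow> s \<in> I" "\<zero> \<in> I"
proof -
  show sub: "I \<subseteq> carrier P" and down: "\<And>i a. i \<in> I \<Longrightarrow> a \<preceq> i \<Longrightarrow> a \<in> I"
    and "i \<in> I \<Longrightarrow> j \<in> I \<Longrightarrow> i \<oplus> j = Some s \<Longrightarrow> s \<in> I"
    using assms unfolding pideal_def ple_def by blast+
  show "\<zero> \<in> I" using assms down sub zero_ple unfolding pideal_def by blast
qed

text \<open>In (R1) the summands themselves serve as parts; in (R2) all of \<open>b\<close> is
  removed, leaving zero.\<close>

lemma riesz_ideal_carrier: "riesz_ideal P (carrier P)"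
  unfolding riesz_ideal_def
proof (intro conjI)
  show "pideal P (carrier P)"
    unfolding pideal_def using zero_closed sum_closed by blast
  show "riesz1 P (carrier P)"
    unfolding riesz1_def using ple_refl by blast
  have "lquot P b b = \<zero>" "rquot P b b = \<zero>" if "b \<in> carrier P" for b
    using that lquot_eq rquot_eq zero_closed zero_left zero_right by auto
  then show "riesz2 P (carrier P)"
    unfolding riesz2_def using ple_refl zero_left zero_right by (metis option.discI)
qed

end

section \<open>The automorphism, and sums, order and quotients in the unitization\<close>

context gamma_unitization
begin

lemma gamma_bij: "bij_betw \<gamma> (carrier P) (carrier P)"
  using unitizing unfolding unitizing_def gpea_automorphism_def by blast

lemma gamma_closed_carrier: "a \<in> carrier P \<Longrightarrow> \<gamma> a \<in> carrier P"
  using gamma_bij bij_betwE by blast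

lemma gamma_surj:
  assumes "b \<in> carrier P"
  obtains a where "a \<in> carrier P" "b = \<gamma> a"
  using gamma_bij assms unfolding bij_betw_def by blast

lemma gamma_inj: "\<lbrakk>a \<in> carrier P; b \<in> carrier P; \<gamma> a = \<gamma> b\<rbrakk> \<Longrightarrow> a = b"
  using gamma_bij unfolding bij_betw_def by (meson inj_onD)

lemma gamma_sum:
  "\<lbrakk>a \<in> carrier P; b \<in> carrier P\<rbrakk> \<Longrightarrow> \<gamma> a \<oplus> \<gamma> b = map_option \<gamma> (a \<oplus> b)"
  using unitizing unfolding unitizing_def gpea_automorphism_def by blast

lemma gamma_sum_iff:
  "\<lbrakk>a \<in> carrier P; b \<in> carrier P; c \<in> carrier P\<rbrakk> \<Longrightarrow> \<gamma> a \<oplus> \<gamma> b = Some (\<gamma> c) \<longleftrightarrow> a \<oplus> b = Some c"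
  using gamma_sum[of a b] gamma_inj[of _ c] sum_closed[of a b] by auto

lemma gamma_ple_iff:
  assumes "a \<in> carrier P" "b \<in> carrier P"
  shows "\<gamma> a \<preceq> \<gamma> b \<longleftrightarrow> a \<preceq> b"
proof -
  have "\<gamma> ` carrier P = carrier P" using gamma_bij unfolding bij_betw_def by blast
  then have "(\<exists>c\<in>carrier P. \<gamma> a \<oplus> c = Some (\<gamma> b)) \<longleftrightarrow> (\<exists>c\<in>carrier P. \<gamma> a \<oplus> \<gamma> c = Some (\<gamma> b))"
    by (metis (no_types) image_iff)
  then show ?thesis
    using assms gamma_closed_carrier by (simp add: ple_def gamma_sum_iff)
qed

lemma gamma_exchange:
  "\<lbrakk>a \<in> carrier P; b \<in> carrier P\<rbrakk> \<Longrightarrow> \<gamma> a \<oplus> b = None \<longleftrightarrow> b \<oplus> a = None"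
  using unitizing unfolding unitizing_def by blast

lemma eta_eq_iff [simp]: "\<lbrakk>a \<in> carrier P; b \<in> carrier P\<rbrakk> \<Longrightarrow> \<eta> a = \<eta> b \<longleftrightarrow> a = b"
  using eta_inj by (auto dest: inj_onD)

lemma eta_notin [simp]: "a \<in> carrier P \<Longrightarrow> \<eta> a \<notin> carrier P"
  using eta_disjoint by blast

lemma in_U [simp]: "a \<in> carrier P \<Longrightarrow> a \<in> carrier U" "a \<in> carrier P \<Longrightarrow> \<eta> a \<in> carrier U"
  by (auto simp: carrier_U)

lemma U_cases:
  assumes "x \<in> carrier U"
  obtains (P) "x \<in> carrier P" | (eta) a where "a \<in> carrier P" "x = \<eta> a"
  using assms by (auto simp: carrier_U)

text \<open>Trades the quotient for an equation in \<open>P\<close>, to which associativity and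
  cancellation apply directly.\<close>

lemma sum_P_eta_iff:
  assumes "a \<in> carrier P" "b \<in> carrier P"
  shows "a \<oplus>\<^bsub>U\<^esub> \<eta> b = Some x \<longleftrightarrow> (\<exists>c\<in>carrier P. x = \<eta> c \<and> c \<oplus> a = Some b)"
  using assms rquot[of a b] rquot_eq[of a _ b] pleI_right[of a _ b] by (auto simp: sum_P_eta)

lemma sum_eta_P_iff:
  assumes "a \<in> carrier P" "b \<in> carrier P"
  shows "\<eta> a \<oplus>\<^bsub>U\<^esub> b = Some x \<longleftrightarrow> (\<exists>c\<in>carrier P. x = \<eta> c \<and> \<gamma> b \<oplus> c = Some a)"
  using assms lquot[of "\<gamma> b" a] lquot_eq[of "\<gamma> b" _ a] pleI_left[of "\<gamma> b" _ a]
    gamma_closed_carrier[of b]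
  by (auto simp: sum_eta_P)

text \<open>A sum involving the upper copy lies in the upper copy, so elements of \<open>P\<close>
  decompose only within \<open>P\<close>. Hence \<open>P\<close> is a down-set of \<open>U\<close>
  with the same order and quotients.\<close>

lemma sum_eq_P:
  assumes "x \<in> carrier U" "y \<in> carrier U" "s \<in> carrier P"
  shows "x \<oplus>\<^bsub>U\<^esub> y = Some s \<longleftrightarrow> x \<in> carrier P \<and> y \<in> carrier P \<and> x \<oplus> y = Some s"
  using assms(1,2)
  by (cases rule: U_cases[case_product U_cases])
     (use assms(3) in \<open>auto simp: sum_PP sum_P_eta_iff sum_eta_P_iff sum_eta_eta\<close>)

lemma sum_eq_eta:
  assumes "x \<in> carrier P" "y \<in> carrier U" "s \<in> carrier P"
  shows "x \<oplus>\<^bsub>U\<^esub> y = Some (\<eta> s) \<longleftrightarrow> (\<exists>c\<in>carrier P. y = \<eta> c \<and> s \<oplus> x = Some c)" (is ?thesis1)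
    "y \<oplus>\<^bsub>U\<^esub> x = Some (\<eta> s) \<longleftrightarrow> (\<exists>c\<in>carrier P. y = \<eta> c \<and> \<gamma> x \<oplus> s = Some c)" (is ?thesis2)
proof -
  have "?thesis1 \<and> ?thesis2"
    using assms(2)
  proof (cases rule: U_cases)
    case P
    then have "x \<oplus> y \<noteq> Some (\<eta> s)" "y \<oplus> x \<noteq> Some (\<eta> s)" "\<not> (\<exists>c\<in>carrier P. y = \<eta> c)"
      using assms sum_closed eta_notin by blast+
    then show ?thesis using P assms(1) by (auto simp: sum_PP)
  next
    case (eta a)
    then show ?thesis using assms(1,3) by (auto simp: sum_P_eta_iff sum_eta_P_iff)
  qed
  then show ?thesis1 ?thesis2 by blast+
qed

lemma ple_U_P: "b \<in> carrier P \<Longrightarrow> a \<preceq>\<^bsub>U\<^esub> b \<longleftrightarrow> a \<preceq> b"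
  unfolding ple_def using sum_eq_P[of a _ b] in_U(1) by metis

text \<open>The only candidate for a complement of \<open>a\<close> in \<open>\<eta> b\<close> is
  \<open>\<eta> c\<close> with \<open>b \<oplus> a = Some c\<close>.\<close>

lemma ple_U_eta: "\<lbrakk>a \<in> carrier P; b \<in> carrier P\<rbrakk> \<Longrightarrow> a \<preceq>\<^bsub>U\<^esub> \<eta> b \<longleftrightarrow> b \<oplus> a \<noteq> None"
  unfolding ple_def using sum_closed[of b a] by (auto simp: sum_eq_eta)

lemma quot_U_P:
  assumes "a \<preceq> b"
  shows "lquot U a b = lquot P a b" "rquot U b a = rquot P b a"
proof -
  have "a \<in> carrier P" "b \<in> carrier P" using assms unfolding ple_def by auto
  then have "x \<in> carrier U \<and> a \<oplus>\<^bsub>U\<^esub> x = Some b \<longleftrightarrow> x \<in> carrier P \<and> a \<oplus> x = Some b"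
    "x \<in> carrier U \<and> x \<oplus>\<^bsub>U\<^esub> a = Some b \<longleftrightarrow> x \<in> carrier P \<and> x \<oplus> a = Some b" for x
    using sum_eq_P by auto
  then show "lquot U a b = lquot P a b" "rquot U b a = rquot P b a"
    unfolding lquot_def rquot_def by simp+
qed

lemma lquot_U_eta:
  assumes "a \<in> carrier P" "b \<in> carrier P" "b \<oplus> a = Some c"
  shows "lquot U a (\<eta> b) = \<eta> c"
proof -
  have "c \<in> carrier P" using assms sum_closed by blast
  then show ?thesis
    unfolding lquot_def using assms by (intro the_equality) (auto simp: sum_eq_eta)
qed

lemma rquot_U_eta:
  assumes "a \<in> carrier P" "b \<in> carrier P" "\<gamma> a \<oplus> b = Some c"
  shows "rquot U (\<eta> b) a = \<eta> c"
proof -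
  have "c \<in> carrier P" using assms sum_closed gamma_closed_carrier by blast
  then show ?thesis
    unfolding rquot_def using assms by (intro the_equality) (auto simp: sum_eq_eta)
qed

section \<open>Traces on \<open>P\<close> of ideals of \<open>U\<close>\<close>

lemma pideal_Int:
  assumes J: "pideal U J"
  shows "pideal P (J \<inter> carrier P)" "\<zero> \<in> J"
proof -
  have zero: "\<zero> \<preceq>\<^bsub>U\<^esub> x" if "x \<in> carrier U" for x
    using that by (cases rule: U_cases) (auto simp: ple_U_P ple_U_eta zero_ple zero_right zero_closed)
  with J show "\<zero> \<in> J" using in_U(1)[OF zero_closed] unfolding pideal_def by blast
  show "pideal P (J \<inter> carrier P)"
    unfolding pideal_def
  proof (intro conjI ballI allI impI)
    show "J \<inter> carrier P \<noteq> {}" "J \<inter> carrier P \<subseteq> carrier P"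
      using \<open>\<zero> \<in> J\<close> zero_closed by blast+
    fix i assume i: "i \<in> J \<inter> carrier P"
    show "a \<in> J \<inter> carrier P" if "a \<in> carrier P" "a \<preceq> i" for a
    proof -
      have "a \<preceq>\<^bsub>U\<^esub> i" using i that ple_U_P by simp
      then show ?thesis using J i that in_U(1) unfolding pideal_def by blast
    qed
    show "s \<in> J \<inter> carrier P" if "j \<in> J \<inter> carrier P" "i \<oplus> j = Some s" for j s
    proof -
      have "i \<oplus>\<^bsub>U\<^esub> j = Some s" using i that sum_PP by simp
      then have "s \<in> J" using J i that unfolding pideal_def by blast
      then show ?thesis using i that sum_closed by blast
    qed
  qed
qed

lemma normal_Int:
  assumes "normal U J"
  shows "normal P (J \<inter> carrier P)"
  unfolding normal_def
proof (intro ballI allI impI, elim conjE)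
  fix a b c s
  assume C: "a \<in> carrier P" "b \<in> carrier P" "c \<in> carrier P" and "a \<oplus> c = Some s" "c \<oplus> b = Some s"
  then have "a \<oplus>\<^bsub>U\<^esub> c = Some s" "c \<oplus>\<^bsub>U\<^esub> b = Some s" using sum_PP by auto
  then have "a \<in> J \<longleftrightarrow> b \<in> J" using assms C in_U(1) unfolding normal_def by blast
  then show "a \<in> J \<inter> carrier P \<longleftrightarrow> b \<in> J \<inter> carrier P" using C by blast
qed

text \<open>\<open>\<gamma> a\<close> and \<open>a\<close> are conjugate in \<open>U\<close>: \<open>\<gamma> a \<oplus> \<eta> (\<gamma> a) = 1 = \<eta> (\<gamma> a) \<oplus> a\<close>.\<close>

lemma gamma_closed_Int:
  assumes "normal U J"
  shows "gamma_closed P \<gamma> (J \<inter> carrier P)"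
  unfolding gamma_closed_def
proof
  fix a assume a: "a \<in> carrier P"
  note ga = gamma_closed_carrier[OF a]
  have "\<gamma> a \<oplus>\<^bsub>U\<^esub> \<eta> (\<gamma> a) = Some (\<eta> \<zero>)" "\<eta> (\<gamma> a) \<oplus>\<^bsub>U\<^esub> a = Some (\<eta> \<zero>)"
    using a ga zero_closed zero_left zero_right by (auto simp: sum_eq_eta)
  then have "\<gamma> a \<in> J \<longleftrightarrow> a \<in> J"
    using assms a ga in_U unfolding normal_def by blast
  then show "a \<in> J \<inter> carrier P \<longleftrightarrow> \<gamma> a \<in> J \<inter> carrier P" using a ga by blast
qed

text \<open>The parts found in \<open>U\<close> lie below \<open>a\<close> and \<open>b\<close>,
  hence in \<open>P\<close>. The same reason gives (R2) for the trace.\<close>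

lemma riesz1_Int:
  assumes "riesz1 U J"
  shows "riesz1 P (J \<inter> carrier P)"
  unfolding riesz1_def
proof (intro ballI allI impI)
  fix i a b s
  assume i: "i \<in> J \<inter> carrier P" and a: "a \<in> carrier P" and b: "b \<in> carrier P"
    and s: "a \<oplus> b = Some s \<and> i \<preceq> s"
  have sC: "s \<in> carrier P" using sum_closed a b s by blast
  then obtain j k t where jk: "j \<in> J" "k \<in> J" "j \<preceq>\<^bsub>U\<^esub> a" "k \<preceq>\<^bsub>U\<^esub> b" "j \<oplus>\<^bsub>U\<^esub> k = Some t" "i \<preceq>\<^bsub>U\<^esub> t"
    using assms[unfolded riesz1_def, rule_format, of i a b s] i a b s in_U(1) sum_PP ple_U_P by auto
  then have "j \<preceq> a" "k \<preceq> b" using ple_U_P a b by auto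
  then have C: "j \<in> carrier P" "k \<in> carrier P" unfolding ple_def by auto
  then have "j \<oplus> k = Some t" using jk sum_PP by simp
  moreover have "i \<preceq> t" using jk ple_U_P sum_closed[OF C \<open>j \<oplus> k = Some t\<close>] by blast
  ultimately show "\<exists>j\<in>J \<inter> carrier P. \<exists>k\<in>J \<inter> carrier P. \<exists>t. j \<preceq> a \<and> k \<preceq> b \<and> j \<oplus> k = Some t \<and> i \<preceq> t"
    using jk C \<open>j \<preceq> a\<close> \<open>k \<preceq> b\<close> by blast
qed

lemma riesz2_Int:
  assumes "riesz2 U J"
  shows "riesz2 P (J \<inter> carrier P)"
  unfolding riesz2_def
proof (intro ballI impI conjI)
  fix i a b
  assume i: "i \<in> J \<inter> carrier P" and a: "a \<in> carrier P" and b: "b \<in> carrier P" and le: "i \<preceq> a"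
  have leU: "i \<preceq>\<^bsub>U\<^esub> a" using le a ple_U_P by blast
  note q = lquot[OF le] rquot[OF le]
  have down: "j \<preceq> b \<and> j \<in> carrier P" if "j \<preceq>\<^bsub>U\<^esub> b" for j
    using that ple_U_P[OF b] unfolding ple_def by blast
  {
    assume "rquot P a i \<oplus> b \<noteq> None"
    then have "rquot U a i \<oplus>\<^bsub>U\<^esub> b \<noteq> None" using quot_U_P[OF le] q b sum_PP by simp
    then obtain j where j: "j \<in> J" "j \<preceq>\<^bsub>U\<^esub> b" "a \<oplus>\<^bsub>U\<^esub> lquot U j b \<noteq> None"
      using assms i a b leU in_U(1) unfolding riesz2_def by (metis IntD1)
    then show "\<exists>j\<in>J \<inter> carrier P. j \<preceq> b \<and> a \<oplus> lquot P j b \<noteq> None"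
      using down[OF j(2)] quot_U_P lquot sum_PP a by (metis IntI)
  next
    assume "b \<oplus> lquot P i a \<noteq> None"
    then have "b \<oplus>\<^bsub>U\<^esub> lquot U i a \<noteq> None" using quot_U_P[OF le] q b sum_PP by simp
    then obtain j where j: "j \<in> J" "j \<preceq>\<^bsub>U\<^esub> b" "rquot U b j \<oplus>\<^bsub>U\<^esub> a \<noteq> None"
      using assms i a b leU in_U(1) unfolding riesz2_def by (metis IntD1)
    then show "\<exists>j\<in>J \<inter> carrier P. j \<preceq> b \<and> rquot P b j \<oplus> a \<noteq> None"
      using down[OF j(2)] quot_U_P rquot sum_PP a by (metis IntI)
  }
qed

lemma riesz_ideal_Int: "riesz_ideal U J \<Longrightarrow> riesz_ideal P (J \<inter> carrier P)"
  unfolding riesz_ideal_def using pideal_Int riesz1_Int riesz2_Int by blast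

section \<open>Ideals of \<open>P\<close> as ideals of \<open>U\<close>\<close>

lemma pideal_U:
  assumes "pideal P I"
  shows "pideal U I"
  unfolding pideal_def
proof (intro conjI ballI allI impI)
  note sub = pidealD(1)[OF assms]
  show "I \<noteq> {}" "I \<subseteq> carrier U" using pidealD(4)[OF assms] sub in_U(1) by blast+
  fix i assume i: "i \<in> I"
  show "a \<in> I" if "a \<preceq>\<^bsub>U\<^esub> i" for a
    using that i sub ple_U_P pidealD(2)[OF assms i] by blast
  show "s \<in> I" if "j \<in> I" "i \<oplus>\<^bsub>U\<^esub> j = Some s" for j s
  proof -
    have "i \<in> carrier P" "j \<in> carrier P" using i that sub by blast+
    then show ?thesis using that sum_PP pidealD(3)[OF assms i] by simp
  qed
qed

text \<open>If \<open>c\<close> is in the upper copy, then \<open>a\<close> and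
  \<open>\<gamma> b\<close> are conjugate in \<open>P\<close>, so normality in \<open>P\<close>
  combines with \<gamma>-invariance of \<open>I\<close>.\<close>

lemma normal_U:
  assumes I: "I \<subseteq> carrier P" and n: "normal P I" and g: "gamma_closed P \<gamma> I"
  shows "normal U I"
  unfolding normal_def
proof (intro ballI allI impI, elim conjE)
  fix a b c s
  assume C: "a \<in> carrier U" "b \<in> carrier U" "c \<in> carrier U"
    and ac: "a \<oplus>\<^bsub>U\<^esub> c = Some s" and cb: "c \<oplus>\<^bsub>U\<^esub> b = Some s"
  \<comment> \<open>Conjugate elements lie in the same copy: if \<open>c\<close> is in
    \<open>P\<close>, each of \<open>a\<close> and \<open>b\<close> lies in the copy of
    \<open>s\<close>; if \<open>c\<close> is in the upper copy, it admits only summands from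
    \<open>P\<close>.\<close>
  have "a \<in> carrier P \<longleftrightarrow> b \<in> carrier P"
    using C(3)
  proof (cases rule: U_cases)
    case P
    show ?thesis
    proof
      assume a: "a \<in> carrier P"
      then have "s \<in> carrier P" using ac P sum_PP sum_closed[OF a P] by simp
      then show "b \<in> carrier P" using cb C sum_eq_P by blast
    next
      assume b: "b \<in> carrier P"
      then have "s \<in> carrier P" using cb P sum_PP sum_closed[OF P b] by simp
      then show "a \<in> carrier P" using ac C sum_eq_P by blast
    qed
  next
    case (eta c')
    then show ?thesis
      using ac cb C sum_eta_eta by (metis U_cases option.distinct(1))
  qed
  then consider (PP) "a \<in> carrier P" "b \<in> carrier P" | (notin) "a \<notin> carrier P" "b \<notin> carrier P"
    by blast
  then show "a \<in> I \<longleftrightarrow> b \<in> I"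
  proof cases
    case PP
    show ?thesis
      using C(3)
    proof (cases rule: U_cases)
      case P
      then show ?thesis using PP ac cb n unfolding normal_def by (metis sum_PP)
    next
      case (eta c')
      then obtain d where d: "d \<in> carrier P" "s = \<eta> d" "d \<oplus> a = Some c'"
        using ac PP sum_P_eta_iff by blast
      then have "\<gamma> b \<oplus> d = Some c'" using cb PP eta sum_eta_P_iff by auto
      then have "\<gamma> b \<in> I \<longleftrightarrow> a \<in> I"
        using n d PP gamma_closed_carrier unfolding normal_def by blast
      then show ?thesis using g PP unfolding gamma_closed_def by blast
    qed
  next
    case notin
    then show ?thesis using I by blast
  qed
qed

text \<open>With the second summand in the upper copy this is \<open>riesz1_directed\<close>. With
  the first one there, the mirrored form is applied to \<gamma>-images and its parts are pulled back
  along \<open>\<gamma>\<close>.\<close>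

lemma riesz1_U:
  assumes dir: "upward_directed P" and I: "riesz1 P I" "I \<subseteq> carrier P" and g: "gamma_closed P \<gamma> I"
  shows "riesz1 U I"
  unfolding riesz1_def
proof (intro ballI allI impI, elim conjE)
  fix i a b s
  assume i: "i \<in> I" and C: "a \<in> carrier U" "b \<in> carrier U"
    and s: "a \<oplus>\<^bsub>U\<^esub> b = Some s" and le: "i \<preceq>\<^bsub>U\<^esub> s"
  have iC: "i \<in> carrier P" using i I by blast
  have toU: "\<exists>j\<in>I. \<exists>k\<in>I. \<exists>t. j \<preceq>\<^bsub>U\<^esub> a \<and> k \<preceq>\<^bsub>U\<^esub> b \<and> j \<oplus>\<^bsub>U\<^esub> k = Some t \<and> i \<preceq>\<^bsub>U\<^esub> t"
    if "j \<in> I" "k \<in> I" "j \<oplus> k = Some t" "i \<preceq> t" "j \<preceq>\<^bsub>U\<^esub> a" "k \<preceq>\<^bsub>U\<^esub> b" for j k t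
  proof -
    have "j \<in> carrier P" "k \<in> carrier P" using that I by blast+
    then show ?thesis using that sum_PP ple_U_P sum_closed by metis
  qed
  show "\<exists>j\<in>I. \<exists>k\<in>I. \<exists>t. j \<preceq>\<^bsub>U\<^esub> a \<and> k \<preceq>\<^bsub>U\<^esub> b \<and> j \<oplus>\<^bsub>U\<^esub> k = Some t \<and> i \<preceq>\<^bsub>U\<^esub> t"
    using C
  proof (cases rule: U_cases[case_product U_cases])
    case P_P
    then have "a \<oplus> b = Some s" using s sum_PP by simp
    moreover from this have "i \<preceq> s" using le P_P sum_closed ple_U_P by blast
    ultimately show ?thesis
      using riesz1E[OF I i _ _ P_P] toU ple_U_P P_P by metis
  next
    case (P_eta b')
    then obtain d where d: "d \<in> carrier P" "s = \<eta> d" "d \<oplus> a = Some b'"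
      using s sum_P_eta_iff by blast
    then obtain t where t: "d \<oplus> i = Some t" using le iC ple_U_eta by auto
    obtain j k v where jk: "j \<in> I" "k \<in> I" "j \<preceq> a" "j \<oplus> k = Some v" "i \<preceq> v" "b' \<oplus> k \<noteq> None"
      using riesz1_directed[OF dir I i P_eta(1) d(1) d(3) t] by metis
    then have "j \<preceq>\<^bsub>U\<^esub> a" "k \<preceq>\<^bsub>U\<^esub> b" using P_eta ple_U_P ple_U_eta I by auto
    then show ?thesis using jk toU by blast
  next
    case (eta_P a')
    then obtain d where d: "d \<in> carrier P" "s = \<eta> d" "\<gamma> b \<oplus> d = Some a'"
      using s sum_eta_P_iff by blast
    \<comment> \<open>That \<open>i\<close> lies below \<open>\<eta> d\<close> means that
      \<open>d \<oplus> i\<close> is defined; unitizing exchanges the order at the cost of a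
      \<open>\<gamma>\<close>.\<close>
    have "\<gamma> i \<oplus> d \<noteq> None" using le iC d ple_U_eta gamma_exchange by auto
    then obtain t where t: "\<gamma> i \<oplus> d = Some t" by blast
    have gi: "\<gamma> i \<in> I" using g i iC unfolding gamma_closed_def by blast
    \<comment> \<open>Duality reverses the parts: \<open>k'\<close> lies below
      \<open>\<gamma> b\<close>, and definedness of \<open>j' \<oplus> a'\<close> puts the preimage
      of \<open>j'\<close> below \<open>\<eta> a'\<close>.\<close>
    obtain k' j' v' where jk: "k' \<in> I" "j' \<in> I" "k' \<preceq> \<gamma> b" "j' \<oplus> k' = Some v'" "\<gamma> i \<preceq> v'" "j' \<oplus> a' \<noteq> None"
      using riesz1_directed'[OF dir I gi gamma_closed_carrier[OF eta_P(3)] d(1) d(3) t]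
      by (metis option.distinct(1))
    then have C': "j' \<in> carrier P" "k' \<in> carrier P" "v' \<in> carrier P" using I sum_closed by blast+
    then obtain j k v where jkv: "j \<in> carrier P" "j' = \<gamma> j" "k \<in> carrier P" "k' = \<gamma> k"
      "v \<in> carrier P" "v' = \<gamma> v" by (metis gamma_surj)
    have "j \<in> I" "k \<in> I" using jkv jk g unfolding gamma_closed_def by auto
    moreover have "j \<oplus> k = Some v" "i \<preceq> v" using jk jkv iC gamma_sum_iff gamma_ple_iff by auto
    moreover have "k \<preceq>\<^bsub>U\<^esub> b" using jk jkv gamma_ple_iff ple_U_P eta_P by auto
    moreover have "j \<preceq>\<^bsub>U\<^esub> a" using jk jkv ple_U_eta eta_P gamma_exchange by auto
    ultimately show ?thesis using toU by blast
  next
    case eta_eta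
    then show ?thesis using s sum_eta_eta by simp
  qed
qed

text \<open>Each mixed case becomes an inequality in \<open>P\<close>, handled by compensation if
  \<open>b\<close> is in the upper copy and by subtraction if \<open>a\<close> is.\<close>

lemma riesz2_U:
  assumes dir: "upward_directed P" and I: "riesz1 P I" "I \<subseteq> carrier P" and g: "gamma_closed P \<gamma> I"
    and r2: "riesz2 P I"
  shows "riesz2 U I"
  unfolding riesz2_def
proof (intro ballI impI)
  fix i a b
  assume i: "i \<in> I" and C: "a \<in> carrier U" "b \<in> carrier U" and le: "i \<preceq>\<^bsub>U\<^esub> a"
  have iC: "i \<in> carrier P" using i I by blast
  have gi: "\<gamma> i \<in> I" and giC: "\<gamma> i \<in> carrier P"
    using g i iC gamma_closed_carrier unfolding gamma_closed_def by blast+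
  show "(rquot U a i \<oplus>\<^bsub>U\<^esub> b \<noteq> None \<longrightarrow> (\<exists>j\<in>I. j \<preceq>\<^bsub>U\<^esub> b \<and> a \<oplus>\<^bsub>U\<^esub> lquot U j b \<noteq> None)) \<and>
    (b \<oplus>\<^bsub>U\<^esub> lquot U i a \<noteq> None \<longrightarrow> (\<exists>k\<in>I. k \<preceq>\<^bsub>U\<^esub> b \<and> rquot U b k \<oplus>\<^bsub>U\<^esub> a \<noteq> None))"
    using C
  proof (cases rule: U_cases[case_product U_cases])
    case P_P
    then have le': "i \<preceq> a" using le ple_U_P by blast
    have 1: "rquot U a i \<oplus>\<^bsub>U\<^esub> b = rquot P a i \<oplus> b" "b \<oplus>\<^bsub>U\<^esub> lquot U i a = b \<oplus> lquot P i a"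
      using quot_U_P[OF le'] lquot[OF le'] rquot[OF le'] P_P sum_PP by auto
    have 2: "a \<oplus>\<^bsub>U\<^esub> lquot U j b = a \<oplus> lquot P j b" "rquot U b j \<oplus>\<^bsub>U\<^esub> a = rquot P b j \<oplus> a"
      if "j \<preceq> b" for j
      using quot_U_P[OF that] lquot[OF that] rquot[OF that] P_P sum_PP by auto
    show ?thesis using r2 i P_P le' 1 2 ple_U_P unfolding riesz2_def by metis
  next
    case (P_eta b')
    then have le': "i \<preceq> a" using le ple_U_P by blast
    show ?thesis
    proof (intro conjI impI)
      assume *: "rquot U a i \<oplus>\<^bsub>U\<^esub> b \<noteq> None"
      define c where "c = rquot P a i"
      have c: "c \<in> carrier P" "c \<oplus> i = Some a" using rquot[OF le'] c_def by auto
      \<comment> \<open>Removing \<open>k\<close> from \<open>\<eta> b'\<close> on the left gives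
        \<open>\<eta> v\<close>, so the goal asks exactly for \<open>a\<close> below
        \<open>v = b' \<oplus> k\<close>.\<close>
      have "c \<preceq> b'" using * c quot_U_P[OF le'] P_eta by (auto simp: c_def sum_P_eta split: if_splits)
      then obtain k v where k: "k \<in> I" "b' \<oplus> k = Some v" "a \<preceq> v"
        using riesz1_compensate[OF dir I i c] by metis
      then have kC: "k \<in> carrier P" and vC: "v \<in> carrier P" using I P_eta sum_closed by blast+
      have "k \<preceq>\<^bsub>U\<^esub> b" using k kC P_eta ple_U_eta by simp
      moreover have "a \<oplus>\<^bsub>U\<^esub> lquot U k b \<noteq> None"
        using k kC vC P_eta by (simp add: lquot_U_eta sum_P_eta)
      ultimately show "\<exists>j\<in>I. j \<preceq>\<^bsub>U\<^esub> b \<and> a \<oplus>\<^bsub>U\<^esub> lquot U j b \<noteq> None" using k by blast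
    next
      assume *: "b \<oplus>\<^bsub>U\<^esub> lquot U i a \<noteq> None"
      define c where "c = lquot P i a"
      have c: "c \<in> carrier P" "i \<oplus> c = Some a" using lquot[OF le'] c_def by auto
      have gc: "\<gamma> c \<in> carrier P" "\<gamma> i \<oplus> \<gamma> c = Some (\<gamma> a)"
        using c iC P_eta gamma_closed_carrier gamma_sum_iff by auto
      \<comment> \<open>Dually, removing \<open>k\<close> on the right gives \<open>\<eta> v\<close>
        with \<open>v = \<gamma> k \<oplus> b'\<close>, and adding \<open>a\<close> on the right
        requires \<open>\<gamma> a\<close> below \<open>v\<close>.\<close>
      have "\<gamma> c \<preceq> b'" using * c quot_U_P[OF le'] P_eta by (auto simp: c_def sum_eta_P split: if_splits)
      then obtain k' v where k': "k' \<in> I" "k' \<oplus> b' = Some v" "\<gamma> a \<preceq> v"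
        using riesz1_compensate'[OF dir I gi gc] by metis
      then have k'C: "k' \<in> carrier P" and vC: "v \<in> carrier P" using I P_eta sum_closed by blast+
      obtain k where k: "k \<in> carrier P" "k' = \<gamma> k" using gamma_surj k'C by blast
      have kI: "k \<in> I" using k k' g unfolding gamma_closed_def by blast
      have "k \<preceq>\<^bsub>U\<^esub> b" using k k' P_eta ple_U_eta gamma_exchange[of k b'] by simp
      moreover have "rquot U b k \<oplus>\<^bsub>U\<^esub> a \<noteq> None"
        using k k' vC P_eta by (simp add: rquot_U_eta sum_eta_P)
      ultimately show "\<exists>k\<in>I. k \<preceq>\<^bsub>U\<^esub> b \<and> rquot U b k \<oplus>\<^bsub>U\<^esub> a \<noteq> None" using kI by blast
    qed
  next
    case (eta_P a')
    then obtain w where w: "a' \<oplus> i = Some w" using le iC ple_U_eta by auto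
    moreover from this obtain w' where w': "\<gamma> i \<oplus> a' = Some w'"
      using gamma_exchange[of i a'] iC eta_P by auto
    ultimately have wC: "w \<in> carrier P" "w' \<in> carrier P" using sum_closed iC giC eta_P by blast+
    show ?thesis
    proof (intro conjI impI)
      assume "rquot U a i \<oplus>\<^bsub>U\<^esub> b \<noteq> None"
      \<comment> \<open>Removing \<open>i\<close> on the right turns \<open>\<eta> a'\<close> into
        \<open>\<eta> w'\<close>. The goal is to shrink \<open>b\<close> to some \<open>m\<close>
        with \<open>\<gamma> m\<close> below \<open>a'\<close>.\<close>
      then have "\<gamma> b \<preceq> w'"
        using w' iC wC eta_P by (auto simp: rquot_U_eta sum_eta_P split: if_splits)
      then obtain k' m' where k': "k' \<in> I" "m' \<in> carrier P" "k' \<oplus> m' = Some (\<gamma> b)" "m' \<preceq> a'"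
        using riesz1_subtract'[OF I gi eta_P(1) w'] by metis
      moreover from this have "k' \<in> carrier P" using I by blast
      ultimately obtain k m where k: "k \<in> carrier P" "k' = \<gamma> k" and m: "m \<in> carrier P" "m' = \<gamma> m"
        using gamma_surj by metis
      have kI: "k \<in> I" using k k' g unfolding gamma_closed_def by blast
      have km: "k \<oplus> m = Some b" using k' k m eta_P gamma_sum_iff by simp
      then have kb: "k \<preceq> b" using k m pleI_left by blast
      then have "lquot U k b = m" using quot_U_P lquot_eq km k m by simp
      then have "a \<oplus>\<^bsub>U\<^esub> lquot U k b \<noteq> None" using eta_P m k' by (simp add: sum_eta_P)
      then show "\<exists>j\<in>I. j \<preceq>\<^bsub>U\<^esub> b \<and> a \<oplus>\<^bsub>U\<^esub> lquot U j b \<noteq> None"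
        using kI kb ple_U_P eta_P by blast
    next
      assume "b \<oplus>\<^bsub>U\<^esub> lquot U i a \<noteq> None"
      \<comment> \<open>Removing \<open>i\<close> on the left turns \<open>\<eta> a'\<close> into
        \<open>\<eta> w\<close>. Here \<open>b\<close> itself must shrink to some \<open>m\<close>
        below \<open>a'\<close>.\<close>
      then have "b \<preceq> w"
        using w iC wC eta_P by (auto simp: lquot_U_eta sum_P_eta split: if_splits)
      then obtain k m where k: "k \<in> I" "m \<in> carrier P" "m \<oplus> k = Some b" "m \<preceq> a'"
        using riesz1_subtract[OF I i eta_P(1) w] by metis
      then have kC: "k \<in> carrier P" using I by blast
      then have kb: "k \<preceq> b" using k pleI_right by blast
      then have "rquot U b k = m" using quot_U_P rquot_eq k kC by simp
      then have "rquot U b k \<oplus>\<^bsub>U\<^esub> a \<noteq> None" using eta_P k by (simp add: sum_P_eta)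
      then show "\<exists>k\<in>I. k \<preceq>\<^bsub>U\<^esub> b \<and> rquot U b k \<oplus>\<^bsub>U\<^esub> a \<noteq> None"
        using k kb ple_U_P eta_P by blast
    qed
  next
    case (eta_eta a' b')
    then obtain w where w: "a' \<oplus> i = Some w" using le iC ple_U_eta by auto
    moreover from this obtain w' where w': "\<gamma> i \<oplus> a' = Some w'"
      using gamma_exchange[of i a'] iC eta_eta by auto
    ultimately have "w \<in> carrier P" "w' \<in> carrier P" using sum_closed iC giC eta_eta by blast+
    \<comment> \<open>Both quotients of \<open>a\<close> by \<open>i\<close> lie in the upper copy,
      where no sums exist, so both premises of (R2) fail.\<close>
    then show ?thesis using w w' iC eta_eta by (simp add: lquot_U_eta rquot_U_eta sum_eta_eta)
  qed
qed

lemma normal_riesz_ideal_U: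
  assumes "upward_directed P" "riesz_ideal P I" "normal P I" "gamma_closed P \<gamma> I"
  shows "riesz_ideal U I" "normal U I"
proof -
  have I: "pideal P I" "riesz1 P I" "riesz2 P I"
    using assms(2) unfolding riesz_ideal_def by blast+
  note sub = pidealD(1)[OF I(1)]
  show "riesz_ideal U I"
    unfolding riesz_ideal_def
    using pideal_U[OF I(1)] riesz1_U[OF assms(1) I(2) sub assms(4)]
      riesz2_U[OF assms(1) I(2) sub assms(4) I(3)] by blast
  show "normal U I" by (rule normal_U[OF sub assms(3,4)])
qed

section \<open>Nontrivial traces and the comparison of smallest ideals\<close>

lemma Int_carrier_nontrivial:
  assumes dir: "upward_directed P" and no: "\<not> has_greatest P"
    and J: "pideal U J" and nt: "nontrivial U J"
  shows "nontrivial P (J \<inter> carrier P)"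
  unfolding nontrivial_def
proof
  assume triv: "J \<inter> carrier P = {\<zero>}"
  have "J \<noteq> {\<zero>}" using nt zero_U unfolding nontrivial_def by simp
  then obtain x where x: "x \<in> J" "x \<noteq> \<zero>" using pideal_Int(2)[OF J] by blast
  then have "x \<in> carrier U" using J unfolding pideal_def by blast
  then obtain a where a: "a \<in> carrier P" "x = \<eta> a"
    using x triv by (cases rule: U_cases) auto
  have max: "b = \<zero>" if b: "b \<in> carrier P" "a \<oplus> b \<noteq> None" for b
  proof -
    have "b \<preceq>\<^bsub>U\<^esub> x" using a b ple_U_eta by simp
    then have "b \<in> J" using J x b in_U unfolding pideal_def by blast
    then show ?thesis using b triv by blast
  qed
  have "c \<preceq> a" if c: "c \<in> carrier P" for c
  proof -
    obtain u where u: "a \<preceq> u" "c \<preceq> u" using dir a c unfolding upward_directed_def by blast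
    obtain b where "b \<in> carrier P" "a \<oplus> b = Some u" using u pleE_left by metis
    \<comment> \<open>Only zero can be added to \<open>a\<close>, so the common upper bound of
      \<open>a\<close> and \<open>c\<close> is \<open>a\<close> itself.\<close>
    then have "u = a" using max[of b] a zero_right by force
    then show ?thesis using u by simp
  qed
  then show False using no a unfolding has_greatest_def by blast
qed

end

theorem theorem5p4:
  fixes P U :: "'a partial_alg" and \<gamma> \<eta> :: "'a \<Rightarrow> 'a"
  assumes "gpea P"
    and "upward_directed P"
    and "\<not> has_greatest P"
    and "gamma_unitization P \<gamma> \<eta> U"
  shows "has_smallest (\<lambda>I. riesz_ideal U I \<and> normal U I \<and> nontrivial U I) \<longleftrightarrow>
    has_smallest (\<lambda>I. riesz_ideal P I \<and> normal P I \<and> gamma_closed P \<gamma> I \<and> nontrivial P I)"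
    (is "has_smallest ?QU \<longleftrightarrow> has_smallest ?QP")
proof -
  interpret gamma_unitization P \<gamma> \<eta> U by fact
  have extend: "?QU I" if "?QP I" for I
    using that normal_riesz_ideal_U[OF assms(2)] zero_U unfolding nontrivial_def by simp
  have restrict: "?QP (J \<inter> carrier P)" if "?QU J" for J
    using that riesz_ideal_Int normal_Int gamma_closed_Int
      Int_carrier_nontrivial[OF assms(2,3)] unfolding riesz_ideal_def by blast
  \<comment> \<open>If zero were the only element of \<open>P\<close>, it would be the greatest
    one.\<close>
  have "carrier P \<noteq> {\<zero>\<^bsub>P\<^esub>}"
    using assms(3) zero_ple[OF zero_closed] unfolding has_greatest_def by auto
  moreover have "normal P (carrier P)" "gamma_closed P \<gamma> (carrier P)"
    using gamma_closed_carrier unfolding normal_def gamma_closed_def by auto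
  ultimately have "?QU (carrier P)"
    using extend riesz_ideal_carrier unfolding nontrivial_def by blast
  show ?thesis
  proof
    assume "has_smallest ?QU"
    then obtain I where I: "?QU I" "\<And>J. ?QU J \<Longrightarrow> I \<subseteq> J" unfolding has_smallest_def by blast
    \<comment> \<open>The carrier of \<open>P\<close> is one of the competing ideals of
      \<open>U\<close>, so the smallest lies inside it and is its own trace.\<close>
    then have "I \<inter> carrier P = I" using \<open>?QU (carrier P)\<close> by blast
    then have "?QP I" using restrict[OF I(1)] by simp
    then show "has_smallest ?QP" using I(2) extend unfolding has_smallest_def by blast
  next
    assume "has_smallest ?QP"
    then obtain I where I: "?QP I" "\<And>J. ?QP J \<Longrightarrow> I \<subseteq> J" unfolding has_smallest_def by blast
    \<comment> \<open>A smallest ideal of \<open>P\<close> lies in the trace of every competing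
      \<open>J\<close>.\<close>
    have "I \<subseteq> J" if "?QU J" for J
      using I(2)[OF restrict[OF that]] by blast
    then show "has_smallest ?QU"
      using extend[OF I(1)] unfolding has_smallest_def by blast
  qed
qed

end
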